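(* Let $I\subseteq\mathbb{R}$ be any interval and let $t\in[0,1]$ be fixed. If $f:I\to\mathbb{R}$ is non-symmetrically $t$-affine, then $f$ is $t$-affine.
   Context: Intervals may be open, closed or half-open and are not required to be bounded. A function $f:I\to\mathbb{R}$ is called non-symmetrically $t$-affine if $f(tx+(1-t)y)=tf(x)+(1-t)f(y)$ for all $x,y\in I$ with $x\leq y$. It is called $t$-affine if $f(tx+(1-t)y)=tf(x)+(1-t)f(y)$ for all $x,y\in I$ (no order restriction on $x,y$). *)

theory Defs
  imports "HOL-Analysis.Analysis"
begin

definition nonsym_t_affine_on :: "real \<Rightarrow> real set \<Rightarrow> (real \<Rightarrow> real) \<Rightarrow> bool" where
  "nonsym_t_affine_on t I f \<longleftrightarrow>
     (\<forall>x\<in>I. \<forall>y\<in>I. x \<le> y \<longrightarrow> f (t * x + (1 - t) * y) = t * f x + (1 - t) * f y)"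

definition t_affine_on :: "real \<Rightarrow> real set \<Rightarrow> (real \<Rightarrow> real) \<Rightarrow> bool" where
  "t_affine_on t I f \<longleftrightarrow>
     (\<forall>x\<in>I. \<forall>y\<in>I. f (t * x + (1 - t) * y) = t * f x + (1 - t) * f y)"

end

theory Submission
  imports Defs
begin

text \<open>
  For \<open>t = 0\<close> and \<open>t = 1\<close> the equation holds trivially, so let \<open>0 < t < 1\<close> and put
  \<open>s = 1 - t\<close>. Given the equation for ordered pairs, the equation for the pair \<open>(y, x)\<close> with
  \<open>x \<le> y\<close> is the same as the Wright-type identity
  \<open>f x + f y = f (t x + s y) + f (s x + t y)\<close>, since \<open>f (t x + s y)\<close> is already known.

  Three equally spaced points \<open>p\<close>, \<open>p + h\<close>, \<open>p + 2 h\<close> of \<open>I\<close> yield this identity on the interval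
  \<open>[p + s h, p + s h + h]\<close>: one of the two intermediate points occurring in
  the identity is \<open>p + h\<close>, and the other one and both end points are means, with the weight \<open>t\<close>
  on the smaller point, of two of the three given points
  (\<open>wright_pair_of_three_points\<close>). So the identity holds on every interval that has enough room on
  both sides inside \<open>I\<close>.

  To reach an arbitrary interval \<open>[x, y]\<close>, possibly with end points of \<open>I\<close>, note that each of
  the contractions \<open>z \<mapsto> t z + s y\<close> and \<open>z \<mapsto> t x + s z\<close> commutes with both means, and that \<open>f\<close>
  turns them into affine maps of its values. Hence the identity on the contracted interval implies
  it on \<open>[x, y]\<close> (\<open>wright_pair_of_cut_left\<close>, \<open>wright_pair_of_cut_right\<close>). One contraction towards
  each side already creates the room that the three-point argument needs.
\<close>

definition wright_affine_pair :: "real \<Rightarrow> (real \<Rightarrow> real) \<Rightarrow> real \<Rightarrow> real \<Rightarrow> bool" where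
  "wright_affine_pair t f x y \<longleftrightarrow>
     f x + f y = f (t * x + (1 - t) * y) + f ((1 - t) * x + t * y)"

lemma nonsym_t_affine_onD:
  assumes "nonsym_t_affine_on t I f" "x \<in> I" "y \<in> I" "x \<le> y"
  shows "f (t * x + (1 - t) * y) = t * f x + (1 - t) * f y"
  using assms unfolding nonsym_t_affine_on_def by blast

lemma convex_combination_between:
  fixes x y t :: real
  assumes "t \<in> {0..1}" "x \<le> y"
  shows "x \<le> t * x + (1 - t) * y" "t * x + (1 - t) * y \<le> y"
proof -
  have "0 \<le> (1 - t) * (y - x)" "0 \<le> t * (y - x)"
    using assms by auto
  then show "x \<le> t * x + (1 - t) * y" "t * x + (1 - t) * y \<le> y"
    by (simp_all add: algebra_simps)
qed

text \<open>
  Each side of the Wright identity evaluates to \<open>t * f p + f (p + h) + (1 - t) * f (p + 2 * h)\<close>.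
\<close>

lemma wright_pair_of_three_points:
  assumes I: "is_interval I" and aff: "nonsym_t_affine_on t I f"
    and p: "p \<in> I" "p + 2 * h \<in> I" and h: "0 \<le> h"
  shows "wright_affine_pair t f (p + (1 - t) * h) (p + (1 - t) * h + h)"
proof -
  have q: "p + h \<in> I"
    using mem_is_interval_1_I[OF I p] h by simp
  have "f (p + (1 - t) * h) = t * f p + (1 - t) * f (p + h)"
    using nonsym_t_affine_onD[OF aff p(1) q] h by (simp add: algebra_simps)
  moreover have "f (p + (1 - t) * h + h) = t * f (p + h) + (1 - t) * f (p + 2 * h)"
    using nonsym_t_affine_onD[OF aff q p(2)] h by (simp add: algebra_simps)
  moreover have "f (t * (p + (1 - t) * h) + (1 - t) * (p + (1 - t) * h + h))
      = t * f p + (1 - t) * f (p + 2 * h)"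
    using nonsym_t_affine_onD[OF aff p(1) p(2)] h by (simp add: algebra_simps)
  moreover have "(1 - t) * (p + (1 - t) * h) + t * (p + (1 - t) * h + h) = p + h"
    by (simp add: algebra_simps)
  ultimately show ?thesis
    unfolding wright_affine_pair_def by (simp add: algebra_simps)
qed

text \<open>
  Contracting towards \<open>y\<close> multiplies the defect of the Wright identity by \<open>t\<close>, because the
  contributions of \<open>f y\<close> to the two sides cancel.
\<close>

lemma wright_pair_of_cut_left:
  assumes I: "is_interval I" and t: "t \<in> {0..1}" "t \<noteq> 0"
    and aff: "nonsym_t_affine_on t I f"
    and xy: "x \<in> I" "y \<in> I" "x \<le> y"
    and cut: "wright_affine_pair t f (t * x + (1 - t) * y) y"
  shows "wright_affine_pair t f x y"
proof -
  define c where "c = (\<lambda>z. t * z + (1 - t) * y)"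
  define u where "u = t * x + (1 - t) * y"
  define v where "v = (1 - t) * x + t * y"
  have u: "x \<le> u" "u \<le> y" and v: "x \<le> v" "v \<le> y"
    using convex_combination_between[of t x y] convex_combination_between[of "1 - t" x y] t xy
    by (auto simp: u_def v_def)
  have fc: "f (c z) = t * f z + (1 - t) * f y" if "x \<le> z" "z \<le> y" for z
    unfolding c_def
    using nonsym_t_affine_onD[OF aff mem_is_interval_1_I[OF I xy(1,2) that] xy(2) that(2)] .
  have "f (c x) + f y = f (c u) + f (c v)"
  proof -
    have "c u = t * c x + (1 - t) * y" "c v = (1 - t) * c x + t * y"
      by (simp_all add: c_def u_def v_def algebra_simps)
    moreover have "wright_affine_pair t f (c x) y"
      using cut by (simp only: c_def)
    ultimately show ?thesis
      by (simp only: wright_affine_pair_def)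
  qed
  moreover have "f (c x) = t * f x + (1 - t) * f y" "f (c u) = t * f u + (1 - t) * f y"
    "f (c v) = t * f v + (1 - t) * f y"
    using fc xy(3) u v by auto
  ultimately have "t * (f x + f y) = t * (f u + f v)"
    by algebra
  then show ?thesis
    using t unfolding wright_affine_pair_def u_def v_def by simp
qed

text \<open>
  Reflecting the real line exchanges the two contractions, together with \<open>t\<close> and \<open>1 - t\<close>.
\<close>

lemma wright_pair_of_cut_right:
  assumes I: "is_interval I" and t: "t \<in> {0..1}" "t \<noteq> 1"
    and aff: "nonsym_t_affine_on t I f"
    and xy: "x \<in> I" "y \<in> I" "x \<le> y"
    and cut: "wright_affine_pair t f x (t * x + (1 - t) * y)"
  shows "wright_affine_pair t f x y"
proof -
  define g where "g = (\<lambda>z. f (- z))"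
  have swap: "wright_affine_pair (1 - t) g (- b) (- a) \<longleftrightarrow> wright_affine_pair t f a b" for a b
    by (simp add: wright_affine_pair_def g_def algebra_simps)
  have "nonsym_t_affine_on (1 - t) (uminus ` I) g"
    unfolding nonsym_t_affine_on_def
  proof (intro ballI impI)
    fix a b assume ab: "a \<in> uminus ` I" "b \<in> uminus ` I" "a \<le> b"
    then have "f (t * (- b) + (1 - t) * (- a)) = t * f (- b) + (1 - t) * f (- a)"
      by (intro nonsym_t_affine_onD[OF aff]) auto
    then show "g ((1 - t) * a + (1 - (1 - t)) * b) = (1 - t) * g a + (1 - (1 - t)) * g b"
      by (simp add: g_def algebra_simps)
  qed
  moreover have "is_interval (uminus ` I)"
    using I by simp
  moreover have "1 - t \<in> {0..1}" "1 - t \<noteq> 0" "- y \<in> uminus ` I" "- x \<in> uminus ` I" "- y \<le> - x"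
    using t xy by simp_all
  moreover have "wright_affine_pair (1 - t) g ((1 - t) * (- y) + (1 - (1 - t)) * (- x)) (- x)"
  proof -
    have "(1 - t) * (- y) + (1 - (1 - t)) * (- x) = - (t * x + (1 - t) * y)"
      by (simp add: algebra_simps)
    then show ?thesis
      using cut swap by metis
  qed
  ultimately have "wright_affine_pair (1 - t) g (- y) (- x)"
    using wright_pair_of_cut_left by blast
  then show ?thesis
    by (simp only: swap)
qed

lemma wright_pair_of_nonsym_t_affine:
  assumes I: "is_interval I" and t: "0 < t" "t < 1"
    and aff: "nonsym_t_affine_on t I f"
    and xy: "x \<in> I" "y \<in> I" "x \<le> y"
  shows "wright_affine_pair t f x y"
proof -
  define a where "a = t * x + (1 - t) * y"
  define b where "b = t * a + (1 - t) * y"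
  define h where "h = b - a"
  \<comment> \<open>The left-hand point is chosen so that the three points \<open>p\<close>, \<open>p + h\<close>, \<open>p + 2 * h\<close>
      give the Wright identity on \<open>[a, b]\<close>.\<close>
  define p where "p = a - (1 - t) * h"
  have t01: "t \<in> {0..1}"
    using t by simp
  have a: "x \<le> a" "a \<le> y"
    using convex_combination_between[OF t01 xy(3)] by (auto simp: a_def)
  have a_in: "a \<in> I"
    by (rule mem_is_interval_1_I[OF I xy(1,2) a])
  have h: "h = t * (1 - t) * (y - x)"
    by (simp add: h_def b_def a_def algebra_simps)
  have h0: "0 \<le> h"
    using t xy by (simp add: h)
  \<comment> \<open>All three points lie in \<open>[x, y]\<close>; the factored gaps at both ends show this.\<close>
  have left: "p - x = (1 - t) * (y - x) * (1 - t * (1 - t))"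
    by (simp add: p_def h a_def algebra_simps)
  have right: "y - (p + 2 * h) = t * (y - x) * (1 - (1 - t) * (1 + t))"
    by (simp add: p_def h a_def algebra_simps)
  have "t * (1 - t) \<le> 1"
    using t by (intro mult_le_one) auto
  then have "x \<le> p"
    using left t xy(3) by (smt (verit) mult_nonneg_nonneg)
  moreover have "1 - (1 - t) * (1 + t) = t * t"
    by (simp add: algebra_simps)
  then have "p + 2 * h \<le> y"
    using right t xy(3) by (smt (verit) mult_nonneg_nonneg)
  ultimately have "p \<in> I" "p + 2 * h \<in> I"
    using h0 by (auto intro: mem_is_interval_1_I[OF I xy(1,2)])
  from wright_pair_of_three_points[OF I aff this h0]
  have "wright_affine_pair t f a b"
    by (simp add: p_def h_def)
  then have "wright_affine_pair t f a y"
    using wright_pair_of_cut_right[OF I t01 _ aff a_in xy(2) a(2)] t by (simp add: b_def)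
  then show ?thesis
    using wright_pair_of_cut_left[OF I t01 _ aff xy] t by (simp add: a_def)
qed

theorem theorem3:
  fixes I :: "real set" and t :: real and f :: "real \<Rightarrow> real"
  assumes "is_interval I"
    and "t \<in> {0..1}"
    and "nonsym_t_affine_on t I f"
  shows "t_affine_on t I f"
proof (cases "t = 0 \<or> t = 1")
  case True
  then show ?thesis
    by (auto simp: t_affine_on_def)
next
  case False
  with assms(2) have t: "0 < t" "t < 1"
    by auto
  show ?thesis
    unfolding t_affine_on_def
  proof (intro ballI)
    fix x y assume xy: "x \<in> I" "y \<in> I"
    show "f (t * x + (1 - t) * y) = t * f x + (1 - t) * f y"
    proof (cases "x \<le> y")
      case True
      then show ?thesis
        by (rule nonsym_t_affine_onD[OF assms(3) xy])
    next
      case False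
      then have "y \<le> x"
        by simp
      from wright_pair_of_nonsym_t_affine[OF assms(1) t assms(3) xy(2,1) this]
        nonsym_t_affine_onD[OF assms(3) xy(2,1) this]
      show ?thesis
        by (simp add: wright_affine_pair_def algebra_simps)
    qed
  qed
qed

end
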